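(* Let $\boldsymbol\sigma=\{\sigma_i\}_{i=1}^d$ be a shape partition of a nonnegative tensor $\mathcal A\in\mathbb R_+^{N_1\times\cdots\times N_m}$ and let $\mathbf p=(p_1,\ldots,p_d)\in(1,\infty)^d$. Suppose that $\mathcal A$ is $\boldsymbol\sigma$-strictly nonnegative and $\sum_{i=1}^d|\sigma_i|/p_i<1$. Let $\bar{\mathbf x}\in\mathbb R^{\boldsymbol\sigma}_{++}$ be the unique positive $(\boldsymbol\sigma,\mathbf p)$-eigenvector of $\mathcal A$ and $\bar{\mathbf y}=\log\bar{\mathbf x}$. Then: (i) The problem $$\min_{\mathbf x\in\mathbb R^{\boldsymbol\sigma}_{++}}\ \phi(\mathbf x)\quad\text{s.t.}\quad c(\mathbf x)\le 1$$ has the unique solution $\bar{\mathbf x}$, with optimal value $\phi(\bar{\mathbf x})=r^{(\boldsymbol\sigma,\mathbf p)}(\mathcal A)$. (ii) The problem $$\min_{(\mathbf y,\mu)\in\mathbb R^{\boldsymbol\sigma}\times\mathbb R}\ \mu\quad\text{s.t.}\quad F(\mathbf y)-\mu\mathbf 1\le 0\ \text{ and }\ g(\mathbf y)\le 0$$ has the unique solution $(\bar{\mathbf y},\bar\mu)=\bigl(\log\bar{\mathbf x},\ \log r^{(\boldsymbol\sigma,\mathbf p)}(\mathcal A)\bigr)$.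
   Context: Notation: $[n]=\{1,\ldots,n\}$; $\mathbb R_+$ and $\mathbb R_{++}$ are the nonnegative and positive reals; $\|\cdot\|_p$ is the $\ell_p$-norm; $\mathbf 1$ is the all-ones vector; $\log$, $\exp$, quotients, powers and inequalities of vectors are entrywise. Shape partition: a partition $\boldsymbol\sigma=\{\sigma_i\}_{i=1}^d$ of $[m]$ such that (a) $N_j=N_{j'}$ for all $j,j'\in\sigma_i$ and all $i$; (b) $j\le k$ for all $j\in\sigma_i$, $k\in\sigma_{i+1}$; (c) $|\sigma_i|\le|\sigma_{i+1}|$ for $i\in[d-1]$. Put $\nu_i=|\sigma_i|$, $s_i=\min\sigma_i$, $n_i=N_{s_i}$. Let $\mathbb R^{\boldsymbol\sigma}=\mathbb R^{n_1}\times\cdots\times\mathbb R^{n_d}$, with elements $\mathbf x=(\mathbf x_1,\ldots,\mathbf x_d)$, $\mathbf x_i=(x_{i,1},\ldots,x_{i,n_i})$, and $\mathbb R^{\boldsymbol\sigma}_{+}$, $\mathbb R^{\boldsymbol\sigma}_{++}$ the subsets of entrywise nonnegative, resp. positive, elements. For $\mathbf x\in\mathbb R^{\boldsymbol\sigma}$, $\mathbf x^{[\boldsymbol\sigma]}=(\mathbf x_1,\ldots,\mathbf x_1,\ldots,\mathbf x_d,\ldots,\mathbf x_d)$ with $\mathbf x_i$ repeated $\nu_i$ times. For $\mathcal A=(a_{j_1\cdots j_m})$, $i\in[m]$, $j_i\in[N_i]$ and $(\mathbf z_1,\ldots,\mathbf z_m)\in\mathbb R^{N_1}\times\cdots\times\mathbb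 R^{N_m}$, $\mathscr A_{i,j_i}(\mathbf z_1,\ldots,\mathbf z_m)=\sum_{j_l\in[N_l],\,l\ne i}a_{j_1\cdots j_m}\prod_{l\neq i}z_{l,j_l}$, and $\mathscr A_i=(\mathscr A_{i,1},\ldots,\mathscr A_{i,N_i})$. A pair $(\lambda,\mathbf x)\in\mathbb R\times\mathbb R^{\boldsymbol\sigma}$ is a $(\boldsymbol\sigma,\mathbf p)$-eigenpair of $\mathcal A$ ($\lambda$ an eigenvalue, $\mathbf x$ an eigenvector) if $\mathscr A_{s_i}(\mathbf x^{[\boldsymbol\sigma]})=\lambda\,\psi_{p_i}(\mathbf x_i)$ and $\|\mathbf x_i\|_{p_i}=1$ for all $i\in[d]$, where $\psi_{p}(\mathbf v)$ has entries $|v_j|^{p-1}\mathrm{sign}(v_j)$. The $(\boldsymbol\sigma,\mathbf p)$-spectral radius is $r^{(\boldsymbol\sigma,\mathbf p)}(\mathcal A)=\sup\{|\lambda|:\lambda\text{ is a }(\boldsymbol\sigma,\mathbf p)\text{-eigenvalue of }\mathcal A\}$. Let $M$ be the square matrix of size $n_1+\cdots+n_d$ with $M_{(i,t_i),(j,l_j)}=\frac{\partial}{\partial x_{j,l_j}}\mathscr A_{s_i,t_i}(\mathbf x^{[\boldsymbol\sigma]})\big|_{\mathbf x=\mathbf 1}$. The nonnegative tensor $\mathcal A$ is $\boldsymbol\sigma$-strictly nonnegative if every row of $M$ has a nonzero entry. By the known Perron–Frobenius theorem of Gautier, Tudisco and Hein, under the hypotheses of the claim $\mathcal A$ has a unique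 positive $(\boldsymbol\sigma,\mathbf p)$-eigenvector, and its eigenvalue is $r^{(\boldsymbol\sigma,\mathbf p)}(\mathcal A)$. Functions: for $\mathbf x\in\mathbb R^{\boldsymbol\sigma}_{++}$, $\Phi_{i,j_i}(\mathbf x)=\mathscr A_{s_i,j_i}(\mathbf x^{[\boldsymbol\sigma]})/x_{i,j_i}^{p_i-1}$, $\Phi=(\Phi_{i,j_i})_{i\in[d],j_i\in[n_i]}$, $\phi(\mathbf x)=\max_{i\in[d],j_i\in[n_i]}\Phi_{i,j_i}(\mathbf x)$, $c(\mathbf x)=\|\mathbf x_1\|_{p_1}\cdots\|\mathbf x_d\|_{p_d}$. For $\mathbf y\in\mathbb R^{\boldsymbol\sigma}$, $F(\mathbf y)=\log\Phi(e^{\mathbf y})$ and $g(\mathbf y)=\log c(e^{\mathbf y})=\sum_{i=1}^d p_i^{-1}\log\bigl(\sum_{j_i=1}^{n_i}e^{p_iy_{i,j_i}}\bigr)$. ($\Phi>0$ when $\mathcal A$ is $\boldsymbol\sigma$-strictly nonnegative, so $F$ is well defined.) *)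

theory Defs
  imports "HOL-Analysis.Analysis"
begin

text \<open>
  All indices are 1-based, as in \<open>[n] = {1..n}\<close>. A tensor of format
  \<open>N 1 \<times> \<dots> \<times> N m\<close> is a real function on the multi-indices
  \<open>J \<in> multi_indices m N\<close>, the entry at \<open>J\<close> being $a_{J_1 \cdots J_m}$; its values
  at other arguments are never used.
\<close>

definition multi_indices :: "nat \<Rightarrow> (nat \<Rightarrow> nat) \<Rightarrow> (nat \<Rightarrow> nat) set" where
  "multi_indices m N = (\<Pi>\<^sub>E l\<in>{1..m}. {1..N l})"

text \<open>\<open>tensor_form m N a i j z\<close> is $\mathscr A_{i,j}(z_1,\dots,z_m)$.\<close>

definition tensor_form ::
  "nat \<Rightarrow> (nat \<Rightarrow> nat) \<Rightarrow> ((nat \<Rightarrow> nat) \<Rightarrow> real) \<Rightarrow> nat \<Rightarrow> nat \<Rightarrow> (nat \<Rightarrow> nat \<Rightarrow> real) \<Rightarrow> real" where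
  "tensor_form m N a i j z =
     (\<Sum>J | J \<in> multi_indices m N \<and> J i = j. a J * (\<Prod>l\<in>{1..m} - {i}. z l (J l)))"

text \<open>
  A partition with \<open>d\<close> blocks is given as the family \<open>\<sigma> 1, \<dots>, \<sigma> d\<close>; \<open>partition_on\<close>
  makes the blocks nonempty, and injectivity makes the family list every block once.
\<close>

definition shape_partition :: "nat \<Rightarrow> (nat \<Rightarrow> nat) \<Rightarrow> nat \<Rightarrow> (nat \<Rightarrow> nat set) \<Rightarrow> bool" where
  "shape_partition m N d \<sigma> \<longleftrightarrow>
     partition_on {1..m} (\<sigma> ` {1..d}) \<and> inj_on \<sigma> {1..d} \<and>
     (\<forall>i\<in>{1..d}. \<forall>j\<in>\<sigma> i. \<forall>j'\<in>\<sigma> i. N j = N j') \<and>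
     (\<forall>i\<in>{1..<d}. \<forall>j\<in>\<sigma> i. \<forall>k\<in>\<sigma> (Suc i). j \<le> k) \<and>
     (\<forall>i\<in>{1..<d}. card (\<sigma> i) \<le> card (\<sigma> (Suc i)))"

definition block_start :: "(nat \<Rightarrow> nat set) \<Rightarrow> nat \<Rightarrow> nat" where
  "block_start \<sigma> i = Min (\<sigma> i)"

definition block_dim :: "(nat \<Rightarrow> nat) \<Rightarrow> (nat \<Rightarrow> nat set) \<Rightarrow> nat \<Rightarrow> nat" where
  "block_dim N \<sigma> i = N (block_start \<sigma> i)"

text \<open>The pairs \<open>(i, j)\<close> labelling the coordinates $x_{i,j}$ of $\mathbb R^\sigma$.\<close>

definition coords :: "(nat \<Rightarrow> nat) \<Rightarrow> nat \<Rightarrow> (nat \<Rightarrow> nat set) \<Rightarrow> (nat \<times> nat) set" where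
  "coords N d \<sigma> = (SIGMA i:{1..d}. {1..block_dim N \<sigma> i})"

text \<open>
  $\mathbb R^\sigma$ and $\mathbb R^\sigma_{++}$. The extensional function space fixes the
  values outside the coordinates, so equality of elements is equality of all coordinates.
\<close>

definition block_vecs :: "(nat \<Rightarrow> nat) \<Rightarrow> nat \<Rightarrow> (nat \<Rightarrow> nat set) \<Rightarrow> (nat \<Rightarrow> nat \<Rightarrow> real) set" where
  "block_vecs N d \<sigma> = (\<Pi>\<^sub>E i\<in>{1..d}. \<Pi>\<^sub>E j\<in>{1..block_dim N \<sigma> i}. UNIV)"

definition pos_block_vecs :: "(nat \<Rightarrow> nat) \<Rightarrow> nat \<Rightarrow> (nat \<Rightarrow> nat set) \<Rightarrow> (nat \<Rightarrow> nat \<Rightarrow> real) set" where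
  "pos_block_vecs N d \<sigma> = (\<Pi>\<^sub>E i\<in>{1..d}. \<Pi>\<^sub>E j\<in>{1..block_dim N \<sigma> i}. {0<..})"

definition map_coords ::
  "(nat \<Rightarrow> nat) \<Rightarrow> nat \<Rightarrow> (nat \<Rightarrow> nat set) \<Rightarrow> (real \<Rightarrow> real) \<Rightarrow> (nat \<Rightarrow> nat \<Rightarrow> real) \<Rightarrow> (nat \<Rightarrow> nat \<Rightarrow> real)" where
  "map_coords N d \<sigma> f x = (\<lambda>i\<in>{1..d}. \<lambda>j\<in>{1..block_dim N \<sigma> i}. f (x i j))"

text \<open>
  $x^{[\sigma]}$: the \<open>l\<close>-th component, for \<open>l \<in> {1..m}\<close>, of the tuple in which each block
  \<open>x i\<close> is repeated \<open>card (\<sigma> i)\<close> times.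
\<close>

definition repeat_blocks ::
  "nat \<Rightarrow> (nat \<Rightarrow> nat set) \<Rightarrow> (nat \<Rightarrow> nat \<Rightarrow> real) \<Rightarrow> (nat \<Rightarrow> nat \<Rightarrow> real)" where
  "repeat_blocks d \<sigma> x l = concat (map (\<lambda>i. replicate (card (\<sigma> i)) (x i)) [1..<Suc d]) ! (l - 1)"

text \<open>\<open>sigma_form m N d \<sigma> a i j x\<close> is $\mathscr A_{s_i,j}(x^{[\sigma]})$.\<close>

definition sigma_form ::
  "nat \<Rightarrow> (nat \<Rightarrow> nat) \<Rightarrow> nat \<Rightarrow> (nat \<Rightarrow> nat set) \<Rightarrow> ((nat \<Rightarrow> nat) \<Rightarrow> real) \<Rightarrow>
   nat \<Rightarrow> nat \<Rightarrow> (nat \<Rightarrow> nat \<Rightarrow> real) \<Rightarrow> real" where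
  "sigma_form m N d \<sigma> a i j x = tensor_form m N a (block_start \<sigma> i) j (repeat_blocks d \<sigma> x)"

definition lp_norm :: "real \<Rightarrow> nat \<Rightarrow> (nat \<Rightarrow> real) \<Rightarrow> real" where
  "lp_norm p n v = (\<Sum>j\<in>{1..n}. \<bar>v j\<bar> powr p) powr (1 / p)"

definition psi :: "real \<Rightarrow> real \<Rightarrow> real" where
  "psi p t = \<bar>t\<bar> powr (p - 1) * sgn t"

definition sigma_p_eigenpair ::
  "nat \<Rightarrow> (nat \<Rightarrow> nat) \<Rightarrow> nat \<Rightarrow> (nat \<Rightarrow> nat set) \<Rightarrow> (nat \<Rightarrow> real) \<Rightarrow> ((nat \<Rightarrow> nat) \<Rightarrow> real) \<Rightarrow>
   real \<Rightarrow> (nat \<Rightarrow> nat \<Rightarrow> real) \<Rightarrow> bool" where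
  "sigma_p_eigenpair m N d \<sigma> p a lam x \<longleftrightarrow>
     x \<in> block_vecs N d \<sigma> \<and>
     (\<forall>i\<in>{1..d}.
        (\<forall>j\<in>{1..block_dim N \<sigma> i}. sigma_form m N d \<sigma> a i j x = lam * psi (p i) (x i j)) \<and>
        lp_norm (p i) (block_dim N \<sigma> i) (x i) = 1)"

definition sigma_p_eigenvalue ::
  "nat \<Rightarrow> (nat \<Rightarrow> nat) \<Rightarrow> nat \<Rightarrow> (nat \<Rightarrow> nat set) \<Rightarrow> (nat \<Rightarrow> real) \<Rightarrow> ((nat \<Rightarrow> nat) \<Rightarrow> real) \<Rightarrow> real \<Rightarrow> bool" where
  "sigma_p_eigenvalue m N d \<sigma> p a lam \<longleftrightarrow> (\<exists>x. sigma_p_eigenpair m N d \<sigma> p a lam x)"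

definition sigma_p_eigenvector ::
  "nat \<Rightarrow> (nat \<Rightarrow> nat) \<Rightarrow> nat \<Rightarrow> (nat \<Rightarrow> nat set) \<Rightarrow> (nat \<Rightarrow> real) \<Rightarrow> ((nat \<Rightarrow> nat) \<Rightarrow> real) \<Rightarrow>
   (nat \<Rightarrow> nat \<Rightarrow> real) \<Rightarrow> bool" where
  "sigma_p_eigenvector m N d \<sigma> p a x \<longleftrightarrow> (\<exists>lam. sigma_p_eigenpair m N d \<sigma> p a lam x)"

text \<open>
  The supremum is over a bounded set, because the eigenvectors range over a bounded set,
  and it is used only when an eigenvalue exists.
\<close>

definition spectral_radius ::
  "nat \<Rightarrow> (nat \<Rightarrow> nat) \<Rightarrow> nat \<Rightarrow> (nat \<Rightarrow> nat set) \<Rightarrow> (nat \<Rightarrow> real) \<Rightarrow> ((nat \<Rightarrow> nat) \<Rightarrow> real) \<Rightarrow> real" where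
  "spectral_radius m N d \<sigma> p a = Sup {\<bar>lam\<bar> | lam. sigma_p_eigenvalue m N d \<sigma> p a lam}"

text \<open>
  The entry in row \<open>(i, t)\<close> and column \<open>(j, l)\<close> of the Jacobian at the all-ones vector:
  the derivative in the single coordinate $x_{j,l}$, all others being held at 1.
\<close>

definition jacobian_at_ones ::
  "nat \<Rightarrow> (nat \<Rightarrow> nat) \<Rightarrow> nat \<Rightarrow> (nat \<Rightarrow> nat set) \<Rightarrow> ((nat \<Rightarrow> nat) \<Rightarrow> real) \<Rightarrow>
   nat \<times> nat \<Rightarrow> nat \<times> nat \<Rightarrow> real" where
  "jacobian_at_ones m N d \<sigma> a = (\<lambda>(i, t) (j, l).
     deriv (\<lambda>h. sigma_form m N d \<sigma> a i t (\<lambda>i' j'. if (i', j') = (j, l) then h else 1)) 1)"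

definition sigma_strictly_nonnegative ::
  "nat \<Rightarrow> (nat \<Rightarrow> nat) \<Rightarrow> nat \<Rightarrow> (nat \<Rightarrow> nat set) \<Rightarrow> ((nat \<Rightarrow> nat) \<Rightarrow> real) \<Rightarrow> bool" where
  "sigma_strictly_nonnegative m N d \<sigma> a \<longleftrightarrow>
     (\<forall>u\<in>coords N d \<sigma>. \<exists>v\<in>coords N d \<sigma>. jacobian_at_ones m N d \<sigma> a u v \<noteq> 0)"

definition Phi ::
  "nat \<Rightarrow> (nat \<Rightarrow> nat) \<Rightarrow> nat \<Rightarrow> (nat \<Rightarrow> nat set) \<Rightarrow> (nat \<Rightarrow> real) \<Rightarrow> ((nat \<Rightarrow> nat) \<Rightarrow> real) \<Rightarrow>
   nat \<Rightarrow> nat \<Rightarrow> (nat \<Rightarrow> nat \<Rightarrow> real) \<Rightarrow> real" where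
  "Phi m N d \<sigma> p a i j x = sigma_form m N d \<sigma> a i j x / x i j powr (p i - 1)"

definition phi ::
  "nat \<Rightarrow> (nat \<Rightarrow> nat) \<Rightarrow> nat \<Rightarrow> (nat \<Rightarrow> nat set) \<Rightarrow> (nat \<Rightarrow> real) \<Rightarrow> ((nat \<Rightarrow> nat) \<Rightarrow> real) \<Rightarrow>
   (nat \<Rightarrow> nat \<Rightarrow> real) \<Rightarrow> real" where
  "phi m N d \<sigma> p a x = (MAX (i, j)\<in>coords N d \<sigma>. Phi m N d \<sigma> p a i j x)"

definition norm_product ::
  "(nat \<Rightarrow> nat) \<Rightarrow> nat \<Rightarrow> (nat \<Rightarrow> nat set) \<Rightarrow> (nat \<Rightarrow> real) \<Rightarrow> (nat \<Rightarrow> nat \<Rightarrow> real) \<Rightarrow> real" where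
  "norm_product N d \<sigma> p x = (\<Prod>i\<in>{1..d}. lp_norm (p i) (block_dim N \<sigma> i) (x i))"

definition log_Phi ::
  "nat \<Rightarrow> (nat \<Rightarrow> nat) \<Rightarrow> nat \<Rightarrow> (nat \<Rightarrow> nat set) \<Rightarrow> (nat \<Rightarrow> real) \<Rightarrow> ((nat \<Rightarrow> nat) \<Rightarrow> real) \<Rightarrow>
   nat \<Rightarrow> nat \<Rightarrow> (nat \<Rightarrow> nat \<Rightarrow> real) \<Rightarrow> real" where
  "log_Phi m N d \<sigma> p a i j y = ln (Phi m N d \<sigma> p a i j (map_coords N d \<sigma> exp y))"

definition log_norm_product ::
  "(nat \<Rightarrow> nat) \<Rightarrow> nat \<Rightarrow> (nat \<Rightarrow> nat set) \<Rightarrow> (nat \<Rightarrow> real) \<Rightarrow> (nat \<Rightarrow> nat \<Rightarrow> real) \<Rightarrow> real" where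
  "log_norm_product N d \<sigma> p y = ln (norm_product N d \<sigma> p (map_coords N d \<sigma> exp y))"

end

theory Submission
  imports Defs
begin

text \<open>
  Write $T_{i,j}(x)$ for $\mathscr A_{s_i,j}(x^{[\sigma]})$ and $\nu_k$ for the size of the
  block $\sigma_k$. Everything follows from one comparison principle (lemma
  \<open>comparison\<close>): if $T(z) \ge \alpha z^{p-1}$ for a nonnegative \<open>z\<close> with no zero block,
  $T(x) \le \beta x^{p-1}$ for a positive \<open>x\<close>, and $0 < \beta \le \alpha$, then
  $z \le x$ entrywise.

  To see this, let $t_k$ be the largest number with $t_k z_k \le x_k$. Each monomial of
  $T_{i,j}$ has degree $\nu_k$ in the block $x_k$, lowered by one for $k = i$, so
  $T_{i,j}(x) \ge t_i^{-1} \prod_k t_k^{\nu_k}\, T_{i,j}(z)$. At a coordinate where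
  $t_i z_{i,j} = x_{i,j}$ the two hypotheses turn this into
  $\prod_k t_k^{\nu_k} \le t_i^{p_i}$. With $S = \sum_k \nu_k \log t_k$ this says
  $\log t_i \ge S / p_i$, hence $S \ge S \sum_k \nu_k / p_k$. As $\sum_k \nu_k / p_k < 1$,
  it follows that $S \ge 0$, and then that every $t_i \ge 1$.

  Let \<open>r\<close> be the eigenvalue of the positive eigenvector $\bar x$; strict nonnegativity makes
  it positive. If \<open>x\<close> is feasible with $\phi(x) \le r$, comparison with $z = \bar x$ gives
  $\bar x \le x$. Each block of \<open>x\<close> then has norm at least 1, while the product of the norms is
  at most 1, so all of them are 1 and $x = \bar x$. If \<open>z\<close> is an eigenvector for an eigenvalue
  of modulus exceeding \<open>r\<close>, comparison of the entrywise absolute value of \<open>z\<close> with $\bar x$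
  gives $|z| \le \bar x$; equal norms force equality in every block, and comparing the
  forms then gives a contradiction. Hence \<open>r\<close> is the spectral radius. The second problem
  is the first in logarithmic coordinates, with an epigraph variable.
\<close>

section \<open>The tuple of repeated blocks\<close>

lemma concat_replicate_nth:
  assumes "n < c i"
  shows "concat (map (\<lambda>i. replicate (c i) (x i)) ([1..<i] @ i # rest)) ! (sum c {1..<i} + n) = x i"
proof -
  have "length (concat (map (\<lambda>i. replicate (c i) (x i)) [1..<i])) = sum c {1..<i}"
    by (simp add: length_concat comp_def sum_list_distinct_conv_sum_set)
  with assms show ?thesis
    by (simp add: nth_append)
qed

definition block_of :: "nat \<Rightarrow> (nat \<Rightarrow> nat set) \<Rightarrow> nat \<Rightarrow> nat" where
  "block_of d \<sigma> l = (THE i. i \<in> {1..d} \<and> l \<in> \<sigma> i)"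

locale shaped_tensor =
  fixes m d :: nat and N :: "nat \<Rightarrow> nat" and \<sigma> :: "nat \<Rightarrow> nat set"
    and a :: "(nat \<Rightarrow> nat) \<Rightarrow> real"
  assumes m_pos: "1 \<le> m"
    and dims_pos: "\<forall>l\<in>{1..m}. 1 \<le> N l"
    and entries_nonneg: "\<forall>J\<in>multi_indices m N. 0 \<le> a J"
    and shape: "shape_partition m N d \<sigma>"
begin

abbreviation T :: "nat \<Rightarrow> nat \<Rightarrow> (nat \<Rightarrow> nat \<Rightarrow> real) \<Rightarrow> real" where
  "T \<equiv> sigma_form m N d \<sigma> a"

abbreviation blk :: "nat \<Rightarrow> nat" where
  "blk \<equiv> block_of d \<sigma>"

lemma partition: "partition_on {1..m} (\<sigma> ` {1..d})"
  and blocks_inj: "inj_on \<sigma> {1..d}"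
  using shape[unfolded shape_partition_def, THEN conjunct1]
    shape[unfolded shape_partition_def, THEN conjunct2, THEN conjunct1] .

lemma block_dims_eq: "i \<in> {1..d} \<Longrightarrow> j \<in> \<sigma> i \<Longrightarrow> j' \<in> \<sigma> i \<Longrightarrow> N j = N j'"
  by (rule shape[unfolded shape_partition_def, THEN conjunct2, THEN conjunct2, THEN conjunct1,
        rule_format])

lemma blocks_le_Suc: "i \<in> {1..<d} \<Longrightarrow> j \<in> \<sigma> i \<Longrightarrow> k \<in> \<sigma> (Suc i) \<Longrightarrow> j \<le> k"
  by (rule shape[unfolded shape_partition_def, THEN conjunct2, THEN conjunct2, THEN conjunct2,
        THEN conjunct1, rule_format])

lemma block_nonempty: "i \<in> {1..d} \<Longrightarrow> \<sigma> i \<noteq> {}"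
  using partition_onD3[OF partition] by (metis imageI)

lemma block_subset: "i \<in> {1..d} \<Longrightarrow> \<sigma> i \<subseteq> {1..m}"
  using partition_onD1[OF partition] by blast

lemma block_finite: "i \<in> {1..d} \<Longrightarrow> finite (\<sigma> i)"
  using block_subset finite_subset by blast

lemma block_disjoint:
  assumes "i \<in> {1..d}" "j \<in> {1..d}" "l \<in> \<sigma> i" "l \<in> \<sigma> j"
  shows "i = j"
proof -
  have "\<sigma> i = \<sigma> j"
    using disjointD[OF partition_onD2[OF partition], of "\<sigma> i" "\<sigma> j"] assms by auto
  with blocks_inj assms show ?thesis
    by (simp add: inj_on_eq_iff)
qed

lemma block_ex: "l \<in> {1..m} \<Longrightarrow> \<exists>i\<in>{1..d}. l \<in> \<sigma> i"
  using partition_onD1[OF partition] by (metis UN_E)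

lemma block_of_eq:
  assumes "i \<in> {1..d}" "l \<in> \<sigma> i"
  shows "blk l = i"
  unfolding block_of_def by (rule the_equality) (use assms block_disjoint in blast)+

lemma block_of_mem:
  assumes "l \<in> {1..m}"
  shows "blk l \<in> {1..d}" "l \<in> \<sigma> (blk l)"
  using block_ex[OF assms] block_of_eq by auto

lemma d_pos: "1 \<le> d"
  using block_of_mem(1)[of 1] m_pos by auto

text \<open>
  The shape condition orders only consecutive blocks, and only weakly. Disjointness makes the
  inequality strict, and nonempty intermediate blocks carry it on to all later blocks.
\<close>

lemma blocks_ordered:
  assumes "1 \<le> i" "i < k" "k \<le> d" "j \<in> \<sigma> i" "l \<in> \<sigma> k"
  shows "j < l"
proof -
  have "\<forall>l\<in>\<sigma> k. j < l" if "k \<le> d"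
    using Suc_leI[OF \<open>i < k\<close>] that
  proof (induction k rule: dec_induct)
    case base
    show ?case
    proof
      fix l assume l: "l \<in> \<sigma> (Suc i)"
      have "j \<le> l"
        using blocks_le_Suc[of i j l] l assms by simp
      moreover have "j \<noteq> l"
        using block_disjoint[of i "Suc i" j] base l assms by auto
      ultimately show "j < l" by simp
    qed
  next
    case (step n)
    then obtain l' where "l' \<in> \<sigma> n"
      using block_nonempty[of n] assms(1) by auto
    with step assms(1) show ?case
      using blocks_le_Suc[of n l'] by fastforce
  qed
  with assms show ?thesis by blast
qed

text \<open>
  By the order of the blocks, the union of the first \<open>e\<close> of them is closed under passing to
  smaller positive indices; such a finite set is an initial segment, as long as its cardinality.
\<close>

lemma initial_blocks:
  assumes "e \<le> d"
  shows "(\<Union>i\<in>{1..e}. \<sigma> i) = {1..(\<Sum>i = 1..e. card (\<sigma> i))}"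
proof -
  let ?U = "\<Union>i\<in>{1..e}. \<sigma> i"
  have fin: "finite ?U"
    using block_finite assms by auto
  have sub: "?U \<subseteq> {1..m}"
    using block_subset assms by force
  have down: "l' \<in> ?U" if l: "l \<in> ?U" and l': "1 \<le> l'" "l' \<le> l" for l l'
  proof -
    from l obtain i where i: "i \<in> {1..e}" "l \<in> \<sigma> i" by blast
    have "l' \<in> {1..m}"
      using l sub l' by fastforce
    then have b: "blk l' \<in> {1..d}" "l' \<in> \<sigma> (blk l')"
      by (rule block_of_mem)+
    have "\<not> i < blk l'"
      using blocks_ordered[of i "blk l'" l l'] i b l' by auto
    with i b show ?thesis by fastforce
  qed
  have "?U = {1..card ?U}"
  proof (cases "?U = {}")
    case True
    then show ?thesis by simp
  next
    case False
    have "?U = {1..Max ?U}"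
    proof (intro equalityI subsetI)
      fix l assume "l \<in> ?U"
      then show "l \<in> {1..Max ?U}"
        using sub Max_ge[OF fin, of l] by (meson atLeastAtMost_iff subsetD)
    next
      fix l assume "l \<in> {1..Max ?U}"
      then show "l \<in> ?U"
        using down[OF Max_in[OF fin False], of l] by (meson atLeastAtMost_iff)
    qed
    then show ?thesis
      using card_atLeastAtMost[of 1 "Max ?U"] by (metis diff_Suc_1 One_nat_def)
  qed
  moreover have "card ?U = (\<Sum>i = 1..e. card (\<sigma> i))"
    using assms by (intro card_UN_disjoint) (use block_finite block_disjoint in \<open>fastforce+\<close>)
  ultimately show ?thesis by metis
qed

text \<open>
  Positions in the concatenated list count the sizes of the earlier blocks. As initial unions of
  blocks are initial segments, the index at a position is exactly a member of the block whose
  vector sits there.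
\<close>

lemma repeat_blocks_nth:
  assumes l: "l \<in> {1..m}"
  shows "repeat_blocks d \<sigma> x l = x (blk l)"
proof -
  define i where "i = blk l"
  have i: "i \<in> {1..d}" "l \<in> \<sigma> i"
    unfolding i_def using block_of_mem[OF l] by auto
  let ?s = "\<Sum>k\<in>{1..<i}. card (\<sigma> k)"
  have iv: "{1..i} = insert i {1..<i}" "{1..i - 1} = {1..<i}"
    using i by auto
  have "l \<in> (\<Union>k\<in>{1..i}. \<sigma> k)"
    using i by auto
  then have "l \<le> (\<Sum>k = 1..i. card (\<sigma> k))"
    using initial_blocks[of i] i(1) by (metis atLeastAtMost_iff)
  also have "\<dots> = ?s + card (\<sigma> i)"
    unfolding iv(1) by (simp add: add.commute)
  finally have "l \<le> ?s + card (\<sigma> i)" .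
  moreover have "l \<notin> (\<Union>k\<in>{1..i - 1}. \<sigma> k)"
  proof
    assume "l \<in> (\<Union>k\<in>{1..i - 1}. \<sigma> k)"
    then obtain k where "k \<in> {1..i - 1}" "l \<in> \<sigma> k" by blast
    moreover from this have "k = i"
      using i by (intro block_disjoint[of k i l]) auto
    ultimately show False using i by auto
  qed
  then have "?s < l"
    using initial_blocks[OF le_trans[OF diff_le_self], of i 1] i l unfolding iv(2)
    by (metis atLeastAtMost_iff linorder_not_le)
  ultimately obtain n where n: "l - 1 = ?s + n" "n < card (\<sigma> i)"
    by (intro that[of "l - 1 - ?s"]) auto
  have "[1..<Suc d] = [1..<i] @ i # [Suc i..<Suc d]"
    using i upt_add_eq_append[of 1 i "Suc d - i"] upt_conv_Cons[of i "Suc d"] by simp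
  then show ?thesis
    unfolding repeat_blocks_def n(1) i_def[symmetric]
    using concat_replicate_nth[of n "\<lambda>k. card (\<sigma> k)" i x "[Suc i..<Suc d]"] n(2) by simp
qed

lemma block_start_mem:
  assumes "i \<in> {1..d}"
  shows "block_start \<sigma> i \<in> \<sigma> i" "block_start \<sigma> i \<in> {1..m}" "blk (block_start \<sigma> i) = i"
proof -
  show *: "block_start \<sigma> i \<in> \<sigma> i"
    unfolding block_start_def using block_finite block_nonempty assms by (intro Min_in)
  then show "block_start \<sigma> i \<in> {1..m}" "blk (block_start \<sigma> i) = i"
    using block_subset[OF assms] block_of_eq[OF assms] by auto
qed

lemma block_dim_blk:
  assumes "l \<in> {1..m}"
  shows "block_dim N \<sigma> (blk l) = N l"
  unfolding block_dim_def
  using block_of_mem[OF assms] block_start_mem(1) block_dims_eq by blast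

lemma block_dim_pos: "i \<in> {1..d} \<Longrightarrow> 1 \<le> block_dim N \<sigma> i"
  unfolding block_dim_def using dims_pos block_start_mem by blast

lemma finite_coords: "finite (coords N d \<sigma>)"
  unfolding coords_def by auto

lemma coords_nonempty: "coords N d \<sigma> \<noteq> {}"
proof -
  have "(1, 1) \<in> coords N d \<sigma>"
    using d_pos block_dim_pos[of 1] by (auto simp: coords_def)
  then show ?thesis by blast
qed

lemma mem_coords: "(i, j) \<in> coords N d \<sigma> \<longleftrightarrow> i \<in> {1..d} \<and> j \<in> {1..block_dim N \<sigma> i}"
  by (auto simp: coords_def)

lemma multi_index_coords:
  assumes "J \<in> multi_indices m N" "l \<in> {1..m}"
  shows "(blk l, J l) \<in> coords N d \<sigma>"
  using assms block_of_mem(1)[OF assms(2)] block_dim_blk[OF assms(2)]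
  unfolding multi_indices_def mem_coords by (auto simp: PiE_iff)

section \<open>Order and homogeneity of the forms\<close>

lemma form_eq:
  assumes i: "i \<in> {1..d}"
  shows "T i j x = (\<Sum>J | J \<in> multi_indices m N \<and> J (block_start \<sigma> i) = j.
           a J * (\<Prod>l\<in>{1..m} - {block_start \<sigma> i}. x (blk l) (J l)))"
  unfolding sigma_form_def tensor_form_def
  by (intro sum.cong prod.cong arg_cong[where f = "\<lambda>t. _ * t"] refl) (simp add: repeat_blocks_nth)

lemma finite_multi_indices: "finite (multi_indices m N)"
  unfolding multi_indices_def by (intro finite_PiE) auto

lemma prod_over_blocks:
  fixes t :: "nat \<Rightarrow> real"
  shows "(\<Prod>l\<in>{1..m}. t (blk l)) = (\<Prod>k\<in>{1..d}. t k ^ card (\<sigma> k))"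
proof -
  have "(\<Prod>l\<in>{1..m}. t (blk l)) = (\<Prod>k\<in>{1..d}. \<Prod>l | l \<in> {1..m} \<and> blk l = k. t (blk l))"
    by (rule prod.group[symmetric]) (use block_of_mem in auto)
  also have "\<dots> = (\<Prod>k\<in>{1..d}. t k ^ card (\<sigma> k))"
  proof (rule prod.cong[OF refl])
    fix k assume k: "k \<in> {1..d}"
    have "{l. l \<in> {1..m} \<and> blk l = k} = \<sigma> k"
      using block_of_mem(2) block_subset[OF k] block_of_eq[OF k] by blast
    then show "(\<Prod>l | l \<in> {1..m} \<and> blk l = k. t (blk l)) = t k ^ card (\<sigma> k)"
      using block_of_eq[OF k] by simp
  qed
  finally show ?thesis .
qed

text \<open>
  Monotonicity and block homogeneity of the forms in a single inequality. The slot
  \<open>block_start \<sigma> i\<close> does not occur in the product, so one factor \<open>t i\<close> is missing from the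
  power product; putting it on the right avoids the exponent \<open>card (\<sigma> i) - 1\<close>.
\<close>

lemma form_scale_mono:
  fixes t :: "nat \<Rightarrow> real"
  assumes i: "i \<in> {1..d}"
    and t: "\<And>k. k \<in> {1..d} \<Longrightarrow> 0 < t k"
    and nonneg: "\<And>k l. (k, l) \<in> coords N d \<sigma> \<Longrightarrow> 0 \<le> z k l"
    and le: "\<And>k l. (k, l) \<in> coords N d \<sigma> \<Longrightarrow> t k * z k l \<le> x k l"
  shows "(\<Prod>k\<in>{1..d}. t k ^ card (\<sigma> k)) * T i j z \<le> t i * T i j x"
proof -
  let ?s = "block_start \<sigma> i"
  let ?L = "{1..m} - {?s}"
  have s: "?s \<in> {1..m}" "blk ?s = i"
    using block_start_mem[OF i] by auto
  have pr: "(\<Prod>k\<in>{1..d}. t k ^ card (\<sigma> k)) = t i * (\<Prod>l\<in>?L. t (blk l))"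
    unfolding prod_over_blocks[symmetric] using s by (subst prod.remove[of _ ?s]) auto
  have "(\<Prod>l\<in>?L. t (blk l)) * T i j z \<le> T i j x"
    unfolding form_eq[OF i] sum_distrib_left
  proof (rule sum_mono)
    fix J assume "J \<in> {J \<in> multi_indices m N. J ?s = j}"
    then have J: "J \<in> multi_indices m N" by simp
    have "(\<Prod>l\<in>?L. t (blk l)) * (\<Prod>l\<in>?L. z (blk l) (J l)) \<le> (\<Prod>l\<in>?L. x (blk l) (J l))"
      unfolding prod.distrib[symmetric]
    proof (intro prod_mono conjI)
      fix l assume "l \<in> ?L"
      then have l: "(blk l, J l) \<in> coords N d \<sigma>" "0 < t (blk l)"
        using multi_index_coords[OF J, of l] t[of "blk l"] block_of_mem(1)[of l] by blast+
      from l nonneg[OF l(1)] show "0 \<le> t (blk l) * z (blk l) (J l)" by simp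
      show "t (blk l) * z (blk l) (J l) \<le> x (blk l) (J l)" by (rule le[OF l(1)])
    qed
    then show "(\<Prod>l\<in>?L. t (blk l)) * (a J * (\<Prod>l\<in>?L. z (blk l) (J l)))
        \<le> a J * (\<Prod>l\<in>?L. x (blk l) (J l))"
      using mult_left_mono[of _ _ "a J"] entries_nonneg J by (simp add: mult.left_commute)
  qed
  then show ?thesis
    unfolding pr mult.assoc using t[OF i] by (intro mult_left_mono) simp_all
qed

lemma abs_form_le:
  assumes i: "i \<in> {1..d}"
  shows "\<bar>T i j z\<bar> \<le> T i j (\<lambda>k l. \<bar>z k l\<bar>)"
  unfolding form_eq[OF i]
  by (rule order.trans[OF sum_abs], rule sum_mono)
     (use entries_nonneg in \<open>auto simp: abs_mult abs_prod\<close>)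

text \<open>
  A form all of whose coefficients vanish would be constant, and so would have a zero row in the
  Jacobian. Thus some monomial has a positive coefficient.
\<close>

lemma form_pos:
  assumes strict: "sigma_strictly_nonnegative m N d \<sigma> a"
    and ij: "(i, j) \<in> coords N d \<sigma>"
    and x: "\<And>k l. (k, l) \<in> coords N d \<sigma> \<Longrightarrow> 0 < x k l"
  shows "0 < T i j x"
proof -
  let ?S = "{J. J \<in> multi_indices m N \<and> J (block_start \<sigma> i) = j}"
  have i: "i \<in> {1..d}" using ij mem_coords by blast
  have "\<exists>J\<in>?S. a J \<noteq> 0"
  proof (rule ccontr)
    assume "\<not> (\<exists>J\<in>?S. a J \<noteq> 0)"
    then have "T i j w = 0" for w
      unfolding form_eq[OF i] by (intro sum.neutral) simp
    then have "jacobian_at_ones m N d \<sigma> a (i, j) v = 0" for v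
      by (cases v) (simp add: jacobian_at_ones_def)
    with strict ij show False
      unfolding sigma_strictly_nonnegative_def by blast
  qed
  then obtain J where J: "J \<in> ?S" "0 < a J"
    using entries_nonneg by force
  have pos: "0 < (\<Prod>l\<in>{1..m} - {block_start \<sigma> i}. x (blk l) (K l))" if "K \<in> ?S" for K
    using that by (intro prod_pos x multi_index_coords) auto
  show ?thesis
    unfolding form_eq[OF i]
  proof (rule sum_pos2[OF _ J(1)])
    show "finite ?S" using finite_multi_indices by simp
    show "0 < a J * (\<Prod>l\<in>{1..m} - {block_start \<sigma> i}. x (blk l) (J l))"
      using J pos by simp
    show "0 \<le> a K * (\<Prod>l\<in>{1..m} - {block_start \<sigma> i}. x (blk l) (K l))" if "K \<in> ?S" for K
      using pos[OF that] entries_nonneg that by simp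
  qed
qed

end

section \<open>The comparison principle\<close>

text \<open>
  Let \<open>S\<close> be the logarithm of the product. Adding the inequalities $\log t_i \ge S / p_i$ with
  weights $c_i$ bounds \<open>S\<close> below by a multiple of itself with factor
  less than one, so \<open>S\<close> cannot be negative.
\<close>

lemma ge_one_of_weighted_product_le:
  fixes t p :: "nat \<Rightarrow> real" and c :: "nat \<Rightarrow> nat"
  assumes p: "\<And>i. i \<in> {1..d} \<Longrightarrow> 0 < p i"
    and t: "\<And>i. i \<in> {1..d} \<Longrightarrow> 0 < t i"
    and sum: "(\<Sum>i\<in>{1..d}. real (c i) / p i) < 1"
    and le: "\<And>i. i \<in> {1..d} \<Longrightarrow> (\<Prod>k\<in>{1..d}. t k ^ c k) \<le> t i powr p i"
    and i: "i \<in> {1..d}"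
  shows "1 \<le> t i"
proof -
  define S where "S = (\<Sum>k\<in>{1..d}. real (c k) * ln (t k))"
  have "ln (\<Prod>k\<in>{1..d}. t k ^ c k) = S"
    unfolding S_def using t by (subst ln_prod) (auto simp: ln_realpow less_imp_neq[symmetric] intro!: sum.cong)
  moreover have "0 < (\<Prod>k\<in>{1..d}. t k ^ c k)"
    using t by (intro prod_pos) simp
  ultimately have S_le: "S \<le> p k * ln (t k)" if "k \<in> {1..d}" for k
    using le[OF that] t[OF that] ln_mono[of "\<Prod>k\<in>{1..d}. t k ^ c k" "t k powr p k"]
    by (simp add: ln_powr)
  have "S * (\<Sum>k\<in>{1..d}. real (c k) / p k) = (\<Sum>k\<in>{1..d}. real (c k) * (S / p k))"
    by (simp add: sum_distrib_left mult.commute)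
  also have "\<dots> \<le> S"
  proof (subst (2) S_def, intro sum_mono mult_left_mono)
    show "S / p k \<le> ln (t k)" if "k \<in> {1..d}" for k
      using S_le[OF that] p[OF that] by (simp add: pos_divide_le_eq mult.commute)
  qed simp
  finally have "0 \<le> S * (1 - (\<Sum>k\<in>{1..d}. real (c k) / p k))"
    by (simp add: algebra_simps)
  with sum have "0 \<le> S"
    by (simp add: zero_le_mult_iff)
  with S_le[OF i] p[OF i] have "0 \<le> ln (t i)"
    by (auto simp: zero_le_mult_iff dest: order.trans)
  with t[OF i] show ?thesis by simp
qed

text \<open>
  Scale each block of the subsolution \<open>z\<close> so that it just touches the supersolution \<open>x\<close> from
  below. The inequalities at the touching coordinates force every scaling factor to be at least 1.
\<close>

lemma (in shaped_tensor) comparison: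
  assumes p: "\<And>i. i \<in> {1..d} \<Longrightarrow> 1 < p i"
    and sum: "(\<Sum>i\<in>{1..d}. real (card (\<sigma> i)) / p i) < 1"
    and z: "\<And>k l. (k, l) \<in> coords N d \<sigma> \<Longrightarrow> 0 \<le> z k l"
    and z_nonzero: "\<And>k. k \<in> {1..d} \<Longrightarrow> \<exists>l\<in>{1..block_dim N \<sigma> k}. z k l \<noteq> 0"
    and x: "\<And>k l. (k, l) \<in> coords N d \<sigma> \<Longrightarrow> 0 < x k l"
    and sub: "\<And>k l. (k, l) \<in> coords N d \<sigma> \<Longrightarrow> \<alpha> * z k l powr (p k - 1) \<le> T k l z"
    and super: "\<And>k l. (k, l) \<in> coords N d \<sigma> \<Longrightarrow> T k l x \<le> \<beta> * x k l powr (p k - 1)"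
    and \<beta>: "0 < \<beta>" "\<beta> \<le> \<alpha>"
    and ij: "(i, j) \<in> coords N d \<sigma>"
  shows "z i j \<le> x i j"
proof -
  let ?I = "\<lambda>k. {1..block_dim N \<sigma> k}"
  \<comment> \<open>The factor is the reciprocal of the largest ratio \<open>z / x\<close>: unlike \<open>x / z\<close>, this ratio makes
    sense also where \<open>z\<close> vanishes.\<close>
  have "\<exists>t l. 0 < t \<and> l \<in> ?I k \<and> x k l = t * z k l \<and> (\<forall>l'\<in>?I k. t * z k l' \<le> x k l')"
    if k: "k \<in> {1..d}" for k
  proof -
    define M where "M = (MAX l\<in>?I k. z k l / x k l)"
    have c: "(k, l) \<in> coords N d \<sigma>" if "l \<in> ?I k" for l
      using k that mem_coords by blast
    have "M \<in> (\<lambda>l. z k l / x k l) ` ?I k"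
      unfolding M_def using block_dim_pos[OF k] by (intro Max_in) auto
    then obtain l where l: "l \<in> ?I k" "M = z k l / x k l" by blast
    have M_ge: "z k l' / x k l' \<le> M" if "l' \<in> ?I k" for l'
      unfolding M_def using that by (intro Max_ge) auto
    obtain l0 where l0: "l0 \<in> ?I k" "z k l0 \<noteq> 0"
      using z_nonzero[OF k] by blast
    then have "0 < z k l0 / x k l0"
      using z[OF c] x[OF c] by (metis divide_pos_pos le_less)
    then have M: "0 < M" using M_ge[OF l0(1)] by linarith
    show ?thesis
    proof (intro exI[of _ "1 / M"] exI[of _ l] conjI ballI)
      show "0 < 1 / M" using M by simp
      show "l \<in> ?I k" by (rule l(1))
      show "x k l = 1 / M * z k l"
        using l M x[OF c[OF l(1)]] by (auto simp: field_simps)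
      show "1 / M * z k l' \<le> x k l'" if "l' \<in> ?I k" for l'
        using M_ge[OF that] M x[OF c[OF that]] by (simp add: field_simps)
    qed
  qed
  then obtain t h where t: "\<And>k. k \<in> {1..d} \<Longrightarrow> 0 < t k"
    and h: "\<And>k. k \<in> {1..d} \<Longrightarrow> h k \<in> ?I k"
    and touch: "\<And>k. k \<in> {1..d} \<Longrightarrow> x k (h k) = t k * z k (h k)"
    and below: "\<And>k l. k \<in> {1..d} \<Longrightarrow> l \<in> ?I k \<Longrightarrow> t k * z k l \<le> x k l"
    by metis
  have "(\<Prod>k\<in>{1..d}. t k ^ card (\<sigma> k)) \<le> t k powr p k" if k: "k \<in> {1..d}" for k
  proof -
    let ?P = "\<Prod>k\<in>{1..d}. t k ^ card (\<sigma> k)"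
    let ?w = "z k (h k) powr (p k - 1)"
    have c: "(k, h k) \<in> coords N d \<sigma>"
      using k h mem_coords by blast
    have zpos: "0 < z k (h k)"
      using x[OF c] touch[OF k] t[OF k] by (simp add: zero_less_mult_iff)
    have P: "0 \<le> ?P"
      using t by (intro prod_nonneg) (simp add: less_imp_le)
    have "?P * (\<beta> * ?w) \<le> ?P * (\<alpha> * ?w)"
      using P \<beta> by (intro mult_left_mono mult_right_mono) auto
    also have "\<dots> \<le> ?P * T k (h k) z"
      using P sub[OF c] by (intro mult_left_mono)
    also have "\<dots> \<le> t k * T k (h k) x"
      by (intro form_scale_mono k t z) (use below mem_coords in auto)
    also have "\<dots> \<le> t k * (\<beta> * x k (h k) powr (p k - 1))"
      using super[OF c] t[OF k] by (intro mult_left_mono) auto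
    also have "\<dots> = (t k * t k powr (p k - 1)) * (\<beta> * ?w)"
      using touch[OF k] t[OF k] zpos by (simp add: powr_mult)
    also have "t k * t k powr (p k - 1) = t k powr p k"
      using t[OF k] by (simp add: powr_mult_base)
    finally show ?thesis
      using \<beta>(1) zpos by simp
  qed
  then have "1 \<le> t i"
    using ij mem_coords p
    by (intro ge_one_of_weighted_product_le[OF _ t sum]) force+
  moreover have "t i * z i j \<le> x i j"
    using below ij mem_coords by blast
  ultimately show ?thesis
    using mult_right_mono[of 1 "t i" "z i j"] z[OF ij] by simp
qed

section \<open>Norms and coordinates\<close>

lemma lp_norm_strict_mono:
  assumes "0 < p" and "\<And>j. j \<in> {1..n} \<Longrightarrow> 0 \<le> u j \<and> u j \<le> v j"
    and "j \<in> {1..n}" "u j < v j"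
  shows "lp_norm p n u < lp_norm p n v"
proof -
  have "(\<Sum>j\<in>{1..n}. \<bar>u j\<bar> powr p) < (\<Sum>j\<in>{1..n}. \<bar>v j\<bar> powr p)"
  proof (rule sum_strict_mono_ex1)
    show "\<forall>k\<in>{1..n}. \<bar>u k\<bar> powr p \<le> \<bar>v k\<bar> powr p"
      using assms(1,2) by (force intro: powr_mono2)
    show "\<exists>k\<in>{1..n}. \<bar>u k\<bar> powr p < \<bar>v k\<bar> powr p"
      using assms by (intro bexI[of _ j] powr_less_mono2) force+
  qed simp
  then show ?thesis
    unfolding lp_norm_def using assms(1) by (intro powr_less_mono2 sum_nonneg) auto
qed

lemma lp_norm_mono:
  assumes "0 < p" and "\<And>j. j \<in> {1..n} \<Longrightarrow> 0 \<le> u j \<and> u j \<le> v j"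
  shows "lp_norm p n u \<le> lp_norm p n v"
  unfolding lp_norm_def using assms
  by (intro powr_mono2 sum_mono sum_nonneg) (force+)

lemma lp_norm_pos:
  assumes "1 \<le> n" "\<And>j. j \<in> {1..n} \<Longrightarrow> 0 < u j"
  shows "0 < lp_norm p n u"
proof -
  have "0 < (\<Sum>j\<in>{1..n}. \<bar>u j\<bar> powr p)"
    using assms by (intro sum_pos) force+
  then show ?thesis unfolding lp_norm_def by simp
qed

lemma factor_eq_one:
  fixes f :: "'a \<Rightarrow> real"
  assumes "finite A" "\<And>i. i \<in> A \<Longrightarrow> 1 \<le> f i" "prod f A \<le> 1" "i \<in> A"
  shows "f i = 1"
proof -
  have "1 \<le> prod f (A - {i})"
    using assms by (intro prod_ge_1) auto
  then have "f i * 1 \<le> f i * prod f (A - {i})"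
    using assms(2)[OF assms(4)] by (intro mult_left_mono) auto
  also have "\<dots> \<le> 1"
    using assms by (simp add: prod.remove[of A i])
  finally show ?thesis
    using assms(2)[OF assms(4)] by simp
qed

lemma pos_block_vecs_iff:
  "x \<in> pos_block_vecs N d \<sigma> \<longleftrightarrow>
     x \<in> block_vecs N d \<sigma> \<and> (\<forall>(i, j)\<in>coords N d \<sigma>. 0 < x i j)"
  unfolding pos_block_vecs_def block_vecs_def coords_def by (auto simp: PiE_iff)

lemma block_vecs_eqI:
  assumes "x \<in> block_vecs N d \<sigma>" "y \<in> block_vecs N d \<sigma>"
    and "\<And>i j. (i, j) \<in> coords N d \<sigma> \<Longrightarrow> x i j = y i j"
  shows "x = y"
proof (rule PiE_ext)
  show x: "x \<in> (\<Pi>\<^sub>E i\<in>{1..d}. \<Pi>\<^sub>E j\<in>{1..block_dim N \<sigma> i}. UNIV)"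
    using assms(1) unfolding block_vecs_def .
  show y: "y \<in> (\<Pi>\<^sub>E i\<in>{1..d}. \<Pi>\<^sub>E j\<in>{1..block_dim N \<sigma> i}. UNIV)"
    using assms(2) unfolding block_vecs_def .
  show "x i = y i" if "i \<in> {1..d}" for i
    using that assms(3) x y by (intro PiE_ext[of "x i" "{1..block_dim N \<sigma> i}" "\<lambda>_. UNIV"])
      (auto simp: coords_def PiE_iff)
qed

lemma map_coords_in: "map_coords N d \<sigma> f x \<in> block_vecs N d \<sigma>"
  unfolding map_coords_def block_vecs_def by auto

lemma map_coords_apply: "(i, j) \<in> coords N d \<sigma> \<Longrightarrow> map_coords N d \<sigma> f x i j = f (x i j)"
  unfolding map_coords_def coords_def by auto

lemma abs_psi: "\<bar>psi p t\<bar> = \<bar>t\<bar> powr (p - 1)"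
  unfolding psi_def by (simp add: abs_mult sgn_if)

section \<open>The positive eigenvector and the spectral radius\<close>

locale positive_eigenpair = shaped_tensor +
  fixes p :: "nat \<Rightarrow> real" and xbar :: "nat \<Rightarrow> nat \<Rightarrow> real" and r :: real
  assumes p_gt_1: "i \<in> {1..d} \<Longrightarrow> 1 < p i"
    and strict: "sigma_strictly_nonnegative m N d \<sigma> a"
    and subhomogeneous: "(\<Sum>i\<in>{1..d}. real (card (\<sigma> i)) / p i) < 1"
    and xbar_pos_vec: "xbar \<in> pos_block_vecs N d \<sigma>"
    and eigenpair: "sigma_p_eigenpair m N d \<sigma> p a r xbar"
begin

lemma xbar_in: "xbar \<in> block_vecs N d \<sigma>"
  and xbar_pos: "(i, j) \<in> coords N d \<sigma> \<Longrightarrow> 0 < xbar i j"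
  using xbar_pos_vec pos_block_vecs_iff by blast+

lemma form_xbar: "(i, j) \<in> coords N d \<sigma> \<Longrightarrow> T i j xbar = r * xbar i j powr (p i - 1)"
  using eigenpair xbar_pos[of i j] unfolding sigma_p_eigenpair_def mem_coords
  by (auto simp: psi_def)

lemma norm_xbar: "i \<in> {1..d} \<Longrightarrow> lp_norm (p i) (block_dim N \<sigma> i) (xbar i) = 1"
  using eigenpair unfolding sigma_p_eigenpair_def by blast

lemma norm_product_xbar: "norm_product N d \<sigma> p xbar = 1"
  unfolding norm_product_def by (rule prod.neutral) (use norm_xbar in blast)

lemma r_pos: "0 < r"
proof -
  obtain i j where ij: "(i, j) \<in> coords N d \<sigma>"
    using coords_nonempty by auto
  have "0 < T i j xbar"
    using xbar_pos by (intro form_pos[OF strict ij])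
  then show ?thesis
    using form_xbar[OF ij] by (simp add: zero_less_mult_iff)
qed

lemma Phi_xbar: "(i, j) \<in> coords N d \<sigma> \<Longrightarrow> Phi m N d \<sigma> p a i j xbar = r"
  unfolding Phi_def using form_xbar[of i j] xbar_pos[of i j] by simp

lemma xbar_block_nonzero: "k \<in> {1..d} \<Longrightarrow> \<exists>l\<in>{1..block_dim N \<sigma> k}. xbar k l \<noteq> 0"
  using block_dim_pos[of k] xbar_pos[of k 1] mem_coords[of k 1] by (intro bexI[of _ 1]) auto

text \<open>
  Comparison puts \<open>x\<close> above \<open>xbar\<close>, while the norm constraint leaves no room above \<open>xbar\<close>. Both
  minimization problems reduce to this rigidity.
\<close>

lemma eq_xbar_if_Phi_le:
  assumes x: "x \<in> pos_block_vecs N d \<sigma>"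
    and norm: "norm_product N d \<sigma> p x \<le> 1"
    and le: "\<And>i j. (i, j) \<in> coords N d \<sigma> \<Longrightarrow> Phi m N d \<sigma> p a i j x \<le> r"
  shows "x = xbar"
proof -
  have x_pos: "0 < x i j" if "(i, j) \<in> coords N d \<sigma>" for i j
    using x that pos_block_vecs_iff by blast
  have xbar_le: "xbar i j \<le> x i j" if ij: "(i, j) \<in> coords N d \<sigma>" for i j
  proof (rule comparison[OF p_gt_1 subhomogeneous _ xbar_block_nonzero x_pos _ _ r_pos order.refl ij])
    fix k l assume kl: "(k, l) \<in> coords N d \<sigma>"
    show "0 \<le> xbar k l" "r * xbar k l powr (p k - 1) \<le> T k l xbar"
      using xbar_pos[OF kl] form_xbar[OF kl] by auto
    show "T k l x \<le> r * x k l powr (p k - 1)"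
      using le[OF kl] x_pos[OF kl] by (simp add: Phi_def pos_divide_le_eq)
  qed
  have below: "0 \<le> xbar i j \<and> xbar i j \<le> x i j"
    if "i \<in> {1..d}" "j \<in> {1..block_dim N \<sigma> i}" for i j
    using that xbar_le[of i j] xbar_pos[of i j] by (simp add: mem_coords)
  have "1 \<le> lp_norm (p i) (block_dim N \<sigma> i) (x i)" if i: "i \<in> {1..d}" for i
    unfolding norm_xbar[OF i, symmetric] using p_gt_1[OF i] below[OF i]
    by (intro lp_norm_mono) auto
  then have norm1: "lp_norm (p i) (block_dim N \<sigma> i) (x i) = 1" if "i \<in> {1..d}" for i
    using norm that unfolding norm_product_def
    by (intro factor_eq_one[of "{1..d}" "\<lambda>i. lp_norm (p i) (block_dim N \<sigma> i) (x i)"]) auto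
  show ?thesis
  proof (rule block_vecs_eqI[OF _ xbar_in])
    show "x \<in> block_vecs N d \<sigma>" using x pos_block_vecs_iff by blast
    fix i j assume "(i, j) \<in> coords N d \<sigma>"
    then have i: "i \<in> {1..d}" and j: "j \<in> {1..block_dim N \<sigma> i}"
      using mem_coords by blast+
    have "\<not> xbar i j < x i j"
      using lp_norm_strict_mono[of "p i" "block_dim N \<sigma> i" "xbar i" "x i" j] below[OF i] j
        p_gt_1[OF i] norm1[OF i] norm_xbar[OF i] by auto
    with below[OF i j] show "x i j = xbar i j" by simp
  qed
qed

text \<open>
  The entrywise absolute value of an eigenvector is a subsolution for the modulus of the eigenvalue.
  If this modulus exceeded \<open>r\<close>, comparison would put it below \<open>xbar\<close>, hence by equality of the
  norms make it equal to \<open>xbar\<close>, whose eigenvalue is only \<open>r\<close>.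
\<close>

lemma abs_eigenvalue_le:
  assumes "sigma_p_eigenpair m N d \<sigma> p a lam z"
  shows "\<bar>lam\<bar> \<le> r"
proof (rule ccontr)
  assume "\<not> \<bar>lam\<bar> \<le> r"
  then have less: "r < \<bar>lam\<bar>" by simp
  let ?z = "\<lambda>k l. \<bar>z k l\<bar>"
  have eq: "T k l z = lam * psi (p k) (z k l)" if "(k, l) \<in> coords N d \<sigma>" for k l
    using assms that unfolding sigma_p_eigenpair_def mem_coords by blast
  have norm_z: "lp_norm (p k) (block_dim N \<sigma> k) (?z k) = 1" if "k \<in> {1..d}" for k
    using assms that unfolding sigma_p_eigenpair_def by (simp add: lp_norm_def)
  have sub: "\<bar>lam\<bar> * ?z k l powr (p k - 1) \<le> T k l ?z" if kl: "(k, l) \<in> coords N d \<sigma>" for k l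
    using abs_form_le[of k l z] kl eq[OF kl] by (simp add: mem_coords abs_mult abs_psi)
  have nonzero: "\<exists>l\<in>{1..block_dim N \<sigma> k}. ?z k l \<noteq> 0" if k: "k \<in> {1..d}" for k
  proof (rule ccontr)
    assume "\<not> ?thesis"
    then have "lp_norm (p k) (block_dim N \<sigma> k) (?z k) = 0"
      by (simp add: lp_norm_def)
    with norm_z[OF k] show False by simp
  qed
  have z_le: "?z k l \<le> xbar k l" if kl: "(k, l) \<in> coords N d \<sigma>" for k l
    by (rule comparison[OF p_gt_1 subhomogeneous _ nonzero xbar_pos sub _ r_pos less_imp_le[OF less] kl])
      (simp_all add: form_xbar)
  obtain i j where ij: "(i, j) \<in> coords N d \<sigma>"
    using coords_nonempty by auto
  then have i: "i \<in> {1..d}" and j: "j \<in> {1..block_dim N \<sigma> i}"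
    using mem_coords by blast+
  have "0 \<le> ?z i l \<and> ?z i l \<le> xbar i l" if "l \<in> {1..block_dim N \<sigma> i}" for l
    using that i z_le[of i l] by (simp add: mem_coords)
  then have "\<not> ?z i j < xbar i j"
    using lp_norm_strict_mono[of "p i" "block_dim N \<sigma> i" "?z i" "xbar i" j] j p_gt_1[OF i] norm_z[OF i] norm_xbar[OF i] by auto
  with z_le[OF ij] have z_eq: "?z i j = xbar i j" by simp
  have "\<bar>lam\<bar> * xbar i j powr (p i - 1) \<le> T i j ?z"
    using sub[OF ij] z_eq by simp
  also have "\<dots> \<le> T i j xbar"
    using form_scale_mono[OF i, of "\<lambda>_. 1" ?z xbar j] z_le by simp
  also have "\<dots> = r * xbar i j powr (p i - 1)"
    by (rule form_xbar[OF ij])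
  finally show False
    using less xbar_pos[OF ij] by simp
qed

lemma spectral_radius_eq: "spectral_radius m N d \<sigma> p a = r"
  unfolding spectral_radius_def
proof (rule cSup_eq_maximum)
  show "r \<in> {\<bar>lam\<bar> |lam. sigma_p_eigenvalue m N d \<sigma> p a lam}"
    using eigenpair r_pos unfolding sigma_p_eigenvalue_def by (auto intro!: exI[of _ r])
  show "s \<le> r" if "s \<in> {\<bar>lam\<bar> |lam. sigma_p_eigenvalue m N d \<sigma> p a lam}" for s
    using that abs_eigenvalue_le unfolding sigma_p_eigenvalue_def by blast
qed

section \<open>The two minimisation problems\<close>

lemma phi_le_iff: "phi m N d \<sigma> p a x \<le> s \<longleftrightarrow> (\<forall>(i, j)\<in>coords N d \<sigma>. Phi m N d \<sigma> p a i j x \<le> s)"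
  unfolding phi_def using finite_coords coords_nonempty by (subst Max_le_iff) auto

lemma phi_xbar: "phi m N d \<sigma> p a xbar = r"
proof -
  have "(\<lambda>(i, j). Phi m N d \<sigma> p a i j xbar) ` coords N d \<sigma> = {r}"
    using Phi_xbar coords_nonempty by force
  then show ?thesis unfolding phi_def by simp
qed

lemma unique_minimizer_phi:
  "is_arg_min (phi m N d \<sigma> p a)
     (\<lambda>x. x \<in> pos_block_vecs N d \<sigma> \<and> norm_product N d \<sigma> p x \<le> 1) x \<longleftrightarrow> x = xbar"
proof -
  have opt: "x = xbar"
    if "x \<in> pos_block_vecs N d \<sigma>" "norm_product N d \<sigma> p x \<le> 1" "phi m N d \<sigma> p a x \<le> r" for x
    using that by (intro eq_xbar_if_Phi_le) (auto simp: phi_le_iff)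
  show ?thesis
    unfolding is_arg_min_def
    using opt xbar_pos_vec norm_product_xbar phi_xbar
    by (metis less_le_not_le linorder_not_le order.refl)
qed

lemma exp_in_pos: "map_coords N d \<sigma> exp y \<in> pos_block_vecs N d \<sigma>"
  using map_coords_in map_coords_apply by (fastforce simp: pos_block_vecs_iff)

text \<open>
  Taking logarithms of the constraint is faithful because \<open>Phi\<close> is positive, which is where
  strict nonnegativity is needed for every point and not only at \<open>xbar\<close>.
\<close>

lemma log_Phi_le_iff:
  assumes ij: "(i, j) \<in> coords N d \<sigma>"
  shows "log_Phi m N d \<sigma> p a i j y - \<mu> \<le> 0 \<longleftrightarrow>
    Phi m N d \<sigma> p a i j (map_coords N d \<sigma> exp y) \<le> exp \<mu>"
proof -
  let ?x = "map_coords N d \<sigma> exp y"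
  have x: "\<And>k l. (k, l) \<in> coords N d \<sigma> \<Longrightarrow> 0 < ?x k l"
    using exp_in_pos pos_block_vecs_iff by blast
  have "0 < Phi m N d \<sigma> p a i j ?x"
    unfolding Phi_def using form_pos[OF strict ij x] x[OF ij] by simp
  then show ?thesis
    unfolding log_Phi_def by (metis diff_le_0_iff_le exp_gt_zero ln_exp ln_le_cancel_iff)
qed

lemma log_norm_product_le_iff:
  "log_norm_product N d \<sigma> p y \<le> 0 \<longleftrightarrow> norm_product N d \<sigma> p (map_coords N d \<sigma> exp y) \<le> 1"
proof -
  have "0 < norm_product N d \<sigma> p (map_coords N d \<sigma> exp y)"
    unfolding norm_product_def
    using block_dim_pos by (intro prod_pos lp_norm_pos) (auto simp: map_coords_def)
  then show ?thesis
    unfolding log_norm_product_def by (simp add: ln_le_zero_iff)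
qed

lemma exp_eq_xbar_iff:
  assumes y: "y \<in> block_vecs N d \<sigma>"
  shows "map_coords N d \<sigma> exp y = xbar \<longleftrightarrow> y = map_coords N d \<sigma> ln xbar"
proof
  assume *: "map_coords N d \<sigma> exp y = xbar"
  show "y = map_coords N d \<sigma> ln xbar"
  proof (rule block_vecs_eqI[OF y map_coords_in])
    fix i j assume ij: "(i, j) \<in> coords N d \<sigma>"
    from map_coords_apply[OF ij, of exp y] show "y i j = map_coords N d \<sigma> ln xbar i j"
      by (simp add: * map_coords_apply[OF ij])
  qed
next
  assume "y = map_coords N d \<sigma> ln xbar"
  then show "map_coords N d \<sigma> exp y = xbar"
    using xbar_pos by (intro block_vecs_eqI[OF map_coords_in xbar_in]) (simp add: map_coords_apply)
qed

text \<open>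
  The constraints at \<open>(y, \<mu>)\<close> say that \<open>exp y\<close> is feasible for the first problem with
  \<open>phi (exp y) \<le> exp \<mu>\<close>. A feasible point with \<open>\<mu> \<le> ln r\<close> therefore has \<open>exp y = xbar\<close>,
  where \<open>phi\<close> takes the value \<open>r\<close>, so that \<open>\<mu>\<close> cannot be smaller than \<open>ln r\<close>.
\<close>

lemma unique_minimizer_log:
  "is_arg_min (\<lambda>(y, \<mu>). \<mu>)
     (\<lambda>(y, \<mu>). y \<in> block_vecs N d \<sigma>
        \<and> (\<forall>(i, j)\<in>coords N d \<sigma>. log_Phi m N d \<sigma> p a i j y - \<mu> \<le> 0)
        \<and> log_norm_product N d \<sigma> p y \<le> 0) (y, \<mu>)
   \<longleftrightarrow> (y, \<mu>) = (map_coords N d \<sigma> ln xbar, ln r)"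
proof -
  let ?feasible = "\<lambda>(y, \<mu>). y \<in> block_vecs N d \<sigma>
    \<and> (\<forall>(i, j)\<in>coords N d \<sigma>. log_Phi m N d \<sigma> p a i j y - \<mu> \<le> 0)
    \<and> log_norm_product N d \<sigma> p y \<le> 0"
  let ?ybar = "map_coords N d \<sigma> ln xbar"
  have feasible_iff: "?feasible (y, \<mu>) \<longleftrightarrow> y \<in> block_vecs N d \<sigma>
      \<and> phi m N d \<sigma> p a (map_coords N d \<sigma> exp y) \<le> exp \<mu>
      \<and> norm_product N d \<sigma> p (map_coords N d \<sigma> exp y) \<le> 1" for y \<mu>
    using log_Phi_le_iff by (auto simp: phi_le_iff log_norm_product_le_iff)
  have exp_ybar: "map_coords N d \<sigma> exp ?ybar = xbar"
    using exp_eq_xbar_iff[OF map_coords_in] by blast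
  have bar: "?feasible (?ybar, ln r)"
    unfolding feasible_iff exp_ybar
    using map_coords_in norm_product_xbar phi_xbar r_pos by simp
  have opt: "y = ?ybar \<and> \<mu> = ln r" if f: "?feasible (y, \<mu>)" and le: "\<mu> \<le> ln r" for y \<mu>
  proof -
    have "exp \<mu> \<le> r"
      using le r_pos by (metis exp_le_cancel_iff exp_ln)
    moreover have F: "y \<in> block_vecs N d \<sigma>"
      "phi m N d \<sigma> p a (map_coords N d \<sigma> exp y) \<le> exp \<mu>"
      "norm_product N d \<sigma> p (map_coords N d \<sigma> exp y) \<le> 1"
      using f unfolding feasible_iff by blast+
    ultimately have x: "map_coords N d \<sigma> exp y = xbar"
      by (intro eq_xbar_if_Phi_le exp_in_pos) (auto simp: phi_le_iff)
    with F phi_xbar have "r \<le> exp \<mu>" by simp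
    then have "ln r \<le> \<mu>"
      using r_pos by (metis exp_le_cancel_iff exp_ln)
    with x le exp_eq_xbar_iff[OF F(1)] show ?thesis by simp
  qed
  show ?thesis
  proof
    assume "is_arg_min (\<lambda>(y, \<mu>). \<mu>) ?feasible (y, \<mu>)"
    then have "?feasible (y, \<mu>)" "\<not> ln r < \<mu>"
      using bar unfolding is_arg_min_def by fast+
    then show "(y, \<mu>) = (?ybar, ln r)"
      using opt[of y \<mu>] by simp
  next
    assume eq: "(y, \<mu>) = (?ybar, ln r)"
    have "\<not> \<mu>' < ln r" if "?feasible (y', \<mu>')" for y' \<mu>'
      using opt[OF that] by auto
    then show "is_arg_min (\<lambda>(y, \<mu>). \<mu>) ?feasible (y, \<mu>)"
      unfolding is_arg_min_def eq using bar by fast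
  qed
qed

end

theorem theorem3p13:
  fixes m d :: nat and N :: "nat \<Rightarrow> nat" and \<sigma> :: "nat \<Rightarrow> nat set"
    and p :: "nat \<Rightarrow> real" and a :: "(nat \<Rightarrow> nat) \<Rightarrow> real" and xbar :: "nat \<Rightarrow> nat \<Rightarrow> real"
  assumes "1 \<le> m" and "\<forall>l\<in>{1..m}. 1 \<le> N l"
    and "\<forall>J\<in>multi_indices m N. 0 \<le> a J"
    and "shape_partition m N d \<sigma>"
    and "\<forall>i\<in>{1..d}. 1 < p i"
    and "sigma_strictly_nonnegative m N d \<sigma> a"
    and "(\<Sum>i\<in>{1..d}. real (card (\<sigma> i)) / p i) < 1"
    and "xbar \<in> pos_block_vecs N d \<sigma>"
    and "sigma_p_eigenvector m N d \<sigma> p a xbar"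
  shows
    "((\<forall>x. is_arg_min (phi m N d \<sigma> p a)
             (\<lambda>x. x \<in> pos_block_vecs N d \<sigma> \<and> norm_product N d \<sigma> p x \<le> 1) x
           \<longleftrightarrow> x = xbar)
      \<and> phi m N d \<sigma> p a xbar = spectral_radius m N d \<sigma> p a)
     \<and>
     (\<forall>y \<mu>. is_arg_min (\<lambda>(y, \<mu>). \<mu>)
             (\<lambda>(y, \<mu>). y \<in> block_vecs N d \<sigma>
                \<and> (\<forall>(i, j)\<in>coords N d \<sigma>. log_Phi m N d \<sigma> p a i j y - \<mu> \<le> 0)
                \<and> log_norm_product N d \<sigma> p y \<le> 0) (y, \<mu>)
           \<longleftrightarrow> (y, \<mu>) = (map_coords N d \<sigma> ln xbar, ln (spectral_radius m N d \<sigma> p a)))"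
proof -
  from assms(9) obtain r where r: "sigma_p_eigenpair m N d \<sigma> p a r xbar"
    unfolding sigma_p_eigenvector_def by blast
  interpret positive_eigenpair m d N \<sigma> a p xbar r
    using assms r by unfold_locales auto
  show ?thesis
    using unique_minimizer_phi phi_xbar unique_minimizer_log unfolding spectral_radius_eq by blast
qed

end
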